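(* Let $M=(M_n)_{n\in\mathbb{N}}$ be a discrete-time normal martingale with the chaotic representation property. Let $F$ be a (complex-valued) function on $\Gamma$. Then $F$ is the Fock transform of an element of $\mathcal{S}^*(M)$ if and only if it satisfies $$|F(\sigma)|\le C\lambda_\sigma^p,\quad \sigma\in\Gamma,$$ where $C\ge0$ and $p\ge0$ are some constants independent of $\sigma\in\Gamma$.
   Context: $\mathbb{N}$ is the set of nonnegative integers and $\Gamma$ is the (countably infinite) set of all finite subsets of $\mathbb{N}$. $(\Omega,\mathcal{F},P)$ is a probability space; $\langle\cdot,\cdot\rangle$ and $\|\cdot\|$ are the inner product (conjugate-linear in the first argument, linear in the second) and norm of the Hilbert space $\mathcal{L}^2(\Omega,\mathcal{F},P)$ of complex-valued square integrable functions. A real-valued square integrable process $M=(M_n)_{n\in\mathbb{N}}$ on $(\Omega,\mathcal{F},P)$ is a discrete-time normal martingale if, with $\mathcal{F}_{-1}=\{\emptyset,\Omega\}$ and $\mathcal{F}_n=\sigma(M_k;0\le k\le n)$: (i) $\mathbb{E}[M_0|\mathcal{F}_{-1}]=0$ and $\mathbb{E}[M_n|\mathcal{F}_{n-1}]=M_{n-1}$ for $n\ge1$; (ii) $\mathbb{E}[M_0^2|\mathcal{F}_{-1}]=1$ and $\mathbb{E}[M_n^2|\mathcal{F}_{n-1}]=M_{n-1}^2+1$ for $n\ge1$. Put $Z_0=M_0$, $Z_n=M_n-M_{n-1}$ for $n\ge1$, $Z_\emptyset=1$, and $Z_\sigma=\prod_{i\in\sigma}Z_i$ for nonempty $\sigma\in\Gamma$;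 $\{Z_\sigma\mid\sigma\in\Gamma\}$ is an orthonormal system in $\mathcal{L}^2(\Omega,\mathcal{F},P)$. Let $\mathcal{F}_\infty=\sigma(M_n;n\in\mathbb{N})$ and $\mathcal{L}^2(M)=\mathcal{L}^2(\Omega,\mathcal{F}_\infty,P)$. $M$ has the chaotic representation property if $\{Z_\sigma\mid\sigma\in\Gamma\}$ is total in $\mathcal{L}^2(M)$ (hence an orthonormal basis of it). Let $\lambda_\emptyset=1$ and $\lambda_\sigma=\prod_{k\in\sigma}(k+1)$ for nonempty $\sigma\in\Gamma$. For $p\ge0$ put $\|\xi\|_p^2=\sum_{\sigma\in\Gamma}\lambda_\sigma^{2p}|\langle Z_\sigma,\xi\rangle|^2$ for $\xi\in\mathcal{L}^2(M)$, and $\mathcal{S}_p(M)=\{\xi\in\mathcal{L}^2(M)\mid\|\xi\|_p<\infty\}$, a Hilbert space with norm $\|\cdot\|_p$. Let $\mathcal{S}(M)=\bigcap_{p=0}^\infty\mathcal{S}_p(M)$ with the topology generated by the norms $\{\|\cdot\|_p\}_{p\ge0}$; all $Z_\sigma$ belong to $\mathcal{S}(M)$. $\mathcal{S}^*(M)$ is the dual of $\mathcal{S}(M)$ (continuous linear functionals); its elements are called generalized functionals of $M$. The Fock transform of $\Phi\in\mathcal{S}^*(M)$ is the function $\widehat{\Phi}$ on $\Gamma$ given by $\widehat{\Phi}(\sigma)=\Phi(Z_\sigma)$, $\sigma\in\Gamma$. *)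

theory Defs
  imports "HOL-Probability.Probability"
begin

section \<open>Discrete-time normal martingales\<close>

text \<open>\<open>process_sigma P M K\<close> is \<open>\<sigma>(M\<^sub>k; k \<in> K)\<close>. Thus \<open>\<F>\<^sub>-\<^sub>1\<close>, which is trivial,
  is the case \<open>K = {}\<close>, \<open>\<F>\<^sub>n\<close> is \<open>K = {..n}\<close>, and \<open>\<F>\<^sub>\<infinity>\<close> is \<open>K = UNIV\<close>.\<close>

definition process_sigma :: "'a measure \<Rightarrow> (nat \<Rightarrow> 'a \<Rightarrow> real) \<Rightarrow> nat set \<Rightarrow> 'a measure" where
  "process_sigma P M K = sigma (space P) {M k -` B \<inter> space P | k B. k \<in> K \<and> B \<in> sets borel}"

locale normal_martingale = prob_space P
  for P :: "'a measure" and M :: "nat \<Rightarrow> 'a \<Rightarrow> real" +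
  assumes measurable_M: "M n \<in> borel_measurable P"
    and square_integrable_M: "integrable P (\<lambda>\<omega>. (M n \<omega>)\<^sup>2)"
    and cond_exp_0: "AE \<omega> in P. real_cond_exp P (process_sigma P M {}) (M 0) \<omega> = 0"
    and cond_exp_Suc:
      "AE \<omega> in P. real_cond_exp P (process_sigma P M {..n}) (M (Suc n)) \<omega> = M n \<omega>"
    and cond_exp_square_0:
      "AE \<omega> in P. real_cond_exp P (process_sigma P M {}) (\<lambda>\<omega>'. (M 0 \<omega>')\<^sup>2) \<omega> = 1"
    and cond_exp_square_Suc:
      "AE \<omega> in P. real_cond_exp P (process_sigma P M {..n}) (\<lambda>\<omega>'. (M (Suc n) \<omega>')\<^sup>2) \<omega>
         = (M n \<omega>)\<^sup>2 + 1"

definition noise :: "(nat \<Rightarrow> 'a \<Rightarrow> real) \<Rightarrow> nat \<Rightarrow> 'a \<Rightarrow> real" where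
  "noise M n \<omega> = (case n of 0 \<Rightarrow> M 0 \<omega> | Suc m \<Rightarrow> M (Suc m) \<omega> - M m \<omega>)"

definition \<Gamma> :: "nat set set" where
  "\<Gamma> = {\<sigma>. finite \<sigma>}"

definition Z :: "(nat \<Rightarrow> 'a \<Rightarrow> real) \<Rightarrow> nat set \<Rightarrow> 'a \<Rightarrow> complex" where
  "Z M \<sigma> \<omega> = complex_of_real (\<Prod>i\<in>\<sigma>. noise M i \<omega>)"


section \<open>Square integrable functionals and the chaotic representation property\<close>

text \<open>Elements of \<open>L\<^sup>2\<close> are represented by functions; representatives that agree almost
  everywhere are not identified.\<close>

definition L2 :: "'a measure \<Rightarrow> ('a \<Rightarrow> complex) set" where
  "L2 N = {f \<in> borel_measurable N. integrable N (\<lambda>\<omega>. (cmod (f \<omega>))\<^sup>2)}"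

definition L2_inner :: "'a measure \<Rightarrow> ('a \<Rightarrow> complex) \<Rightarrow> ('a \<Rightarrow> complex) \<Rightarrow> complex" where
  "L2_inner N f g = (\<integral>\<omega>. cnj (f \<omega>) * g \<omega> \<partial>N)"

definition L2_norm :: "'a measure \<Rightarrow> ('a \<Rightarrow> complex) \<Rightarrow> real" where
  "L2_norm N f = sqrt (\<integral>\<omega>. (cmod (f \<omega>))\<^sup>2 \<partial>N)"

definition L2M :: "'a measure \<Rightarrow> (nat \<Rightarrow> 'a \<Rightarrow> real) \<Rightarrow> ('a \<Rightarrow> complex) set" where
  "L2M P M = L2 (restr_to_subalg P (process_sigma P M UNIV))"

text \<open>Totality: the complex linear span of the \<open>Z\<^sub>\<sigma>\<close> is dense in \<open>\<L>\<^sup>2(M)\<close>.\<close>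

definition chaotic_representation :: "'a measure \<Rightarrow> (nat \<Rightarrow> 'a \<Rightarrow> real) \<Rightarrow> bool" where
  "chaotic_representation P M \<longleftrightarrow>
     (\<forall>\<xi>\<in>L2M P M. \<forall>\<epsilon>>0. \<exists>A c. finite A \<and> A \<subseteq> \<Gamma> \<and>
        L2_norm P (\<lambda>\<omega>. \<xi> \<omega> - (\<Sum>\<sigma>\<in>A. c \<sigma> * Z M \<sigma> \<omega>)) < \<epsilon>)"


section \<open>Testing and generalized functionals\<close>

definition lam :: "nat set \<Rightarrow> real" where
  "lam \<sigma> = (\<Prod>k\<in>\<sigma>. real k + 1)"

definition chaos_term ::
    "'a measure \<Rightarrow> (nat \<Rightarrow> 'a \<Rightarrow> real) \<Rightarrow> real \<Rightarrow> ('a \<Rightarrow> complex) \<Rightarrow> nat set \<Rightarrow> real" where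
  "chaos_term P M p \<xi> \<sigma> = lam \<sigma> powr (2 * p) * (cmod (L2_inner P (Z M \<sigma>) \<xi>))\<^sup>2"

definition Sp :: "'a measure \<Rightarrow> (nat \<Rightarrow> 'a \<Rightarrow> real) \<Rightarrow> real \<Rightarrow> ('a \<Rightarrow> complex) set" where
  "Sp P M p = {\<xi> \<in> L2M P M. chaos_term P M p \<xi> summable_on \<Gamma>}"

definition Sp_norm ::
    "'a measure \<Rightarrow> (nat \<Rightarrow> 'a \<Rightarrow> real) \<Rightarrow> real \<Rightarrow> ('a \<Rightarrow> complex) \<Rightarrow> real" where
  "Sp_norm P M p \<xi> = sqrt (\<Sum>\<^sub>\<infinity>\<sigma>\<in>\<Gamma>. chaos_term P M p \<xi> \<sigma>)"

definition test_functionals :: "'a measure \<Rightarrow> (nat \<Rightarrow> 'a \<Rightarrow> real) \<Rightarrow> ('a \<Rightarrow> complex) set" where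
  "test_functionals P M = (\<Inter>p::nat. Sp P M (real p))"

definition test_topology ::
    "'a measure \<Rightarrow> (nat \<Rightarrow> 'a \<Rightarrow> real) \<Rightarrow> ('a \<Rightarrow> complex) topology" where
  "test_topology P M = topology_generated_by
     {{\<eta> \<in> test_functionals P M. Sp_norm P M p (\<lambda>\<omega>. \<eta> \<omega> - \<xi> \<omega>) < r} | p \<xi> r.
        0 \<le> p \<and> \<xi> \<in> test_functionals P M \<and> 0 < r}"

text \<open>Only the values of \<open>\<Phi>\<close> on \<open>test_functionals P M\<close> matter. Compatibility of \<open>\<Phi>\<close> with
  almost everywhere equality follows from continuity; see \<open>generalized_functional_cong_AE\<close> below.\<close>

definition generalized_functionals ::
    "'a measure \<Rightarrow> (nat \<Rightarrow> 'a \<Rightarrow> real) \<Rightarrow> (('a \<Rightarrow> complex) \<Rightarrow> complex) set" where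
  "generalized_functionals P M = {\<Phi>.
     (\<forall>\<xi>\<in>test_functionals P M. \<forall>\<eta>\<in>test_functionals P M.
        \<Phi> (\<lambda>\<omega>. \<xi> \<omega> + \<eta> \<omega>) = \<Phi> \<xi> + \<Phi> \<eta>) \<and>
     (\<forall>c. \<forall>\<xi>\<in>test_functionals P M. \<Phi> (\<lambda>\<omega>. c * \<xi> \<omega>) = c * \<Phi> \<xi>) \<and>
     continuous_map (test_topology P M) euclidean \<Phi>}"

definition Fock_transform ::
    "(nat \<Rightarrow> 'a \<Rightarrow> real) \<Rightarrow> (('a \<Rightarrow> complex) \<Rightarrow> complex) \<Rightarrow> nat set \<Rightarrow> complex" where
  "Fock_transform M \<Phi> \<sigma> = \<Phi> (Z M \<sigma>)"


section \<open>Compatibility with almost everywhere equality\<close>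

lemma space_process_sigma [simp]: "space (process_sigma P M K) = space P"
  unfolding process_sigma_def by (intro space_measure_of) auto

lemma (in normal_martingale) subalgebra_process_sigma: "subalgebra P (process_sigma P M K)"
proof -
  have gen: "{M k -` B \<inter> space P | k B. k \<in> K \<and> B \<in> sets borel} \<subseteq> sets P"
  proof clarify
    fix k and B :: "real set"
    assume "B \<in> sets borel"
    with measurable_M[of k] show "M k -` B \<inter> space P \<in> sets P"
      by (rule measurable_sets)
  qed
  then have "{M k -` B \<inter> space P | k B. k \<in> K \<and> B \<in> sets borel} \<subseteq> Pow (space P)"
    by (rule subset_trans) (rule sets.space_closed)
  then have "sets (process_sigma P M K) =
      sigma_sets (space P) {M k -` B \<inter> space P | k B. k \<in> K \<and> B \<in> sets borel}"
    unfolding process_sigma_def by (rule sets_measure_of)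
  also have "\<dots> \<subseteq> sets P"
    using gen by (rule sets.sigma_sets_subset)
  finally show ?thesis
    by (simp add: subalgebra_def)
qed

lemma (in normal_martingale) L2M_measurable:
  assumes "\<xi> \<in> L2M P M"
  shows "\<xi> \<in> borel_measurable P"
proof -
  have "\<xi> \<in> borel_measurable (restr_to_subalg P (process_sigma P M UNIV))"
    using assms by (simp add: L2M_def L2_def)
  then have "\<xi> \<in> borel_measurable (process_sigma P M UNIV)"
    using measurable_in_subalg'[OF subalgebra_process_sigma] by blast
  then show ?thesis
    using measurable_from_subalg[OF subalgebra_process_sigma] by blast
qed

lemma (in normal_martingale) Z_measurable: "Z M \<sigma> \<in> borel_measurable P"
proof -
  have "noise M i \<in> borel_measurable P" for i
  proof (cases i)
    case 0
    then show ?thesis using measurable_M[of 0] by (simp add: noise_def[abs_def])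
  next
    case (Suc m)
    then show ?thesis
      using borel_measurable_diff[OF measurable_M[of "Suc m"] measurable_M[of m]]
      by (simp add: noise_def[abs_def])
  qed
  then show ?thesis
    unfolding Z_def[abs_def] by measurable
qed

lemma (in normal_martingale) chaos_term_cong_AE:
  assumes "\<xi> \<in> borel_measurable P" "\<eta> \<in> borel_measurable P" "AE \<omega> in P. \<xi> \<omega> = \<eta> \<omega>"
  shows "chaos_term P M p \<xi> = chaos_term P M p \<eta>"
proof
  fix \<sigma>
  have "L2_inner P (Z M \<sigma>) \<xi> = L2_inner P (Z M \<sigma>) \<eta>"
    unfolding L2_inner_def
  proof (rule integral_cong_AE)
    have Z': "(\<lambda>\<omega>. cnj (Z M \<sigma> \<omega>)) \<in> borel_measurable P"
      by (rule borel_measurable_continuous_on[OF continuous_on_cnj[OF continuous_on_id] Z_measurable])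
    show "(\<lambda>\<omega>. cnj (Z M \<sigma> \<omega>) * \<xi> \<omega>) \<in> borel_measurable P"
      using Z' assms(1) by (rule borel_measurable_times)
    show "(\<lambda>\<omega>. cnj (Z M \<sigma> \<omega>) * \<eta> \<omega>) \<in> borel_measurable P"
      using Z' assms(2) by (rule borel_measurable_times)
    show "AE \<omega> in P. cnj (Z M \<sigma> \<omega>) * \<xi> \<omega> = cnj (Z M \<sigma> \<omega>) * \<eta> \<omega>"
      using assms(3) by eventually_elim simp
  qed
  then show "chaos_term P M p \<xi> \<sigma> = chaos_term P M p \<eta> \<sigma>"
    by (simp add: chaos_term_def)
qed

lemma (in normal_martingale) generalized_functional_cong_AE:
  assumes \<Phi>: "\<Phi> \<in> generalized_functionals P M"
    and f: "f \<in> test_functionals P M" and g: "g \<in> test_functionals P M"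
    and eq: "AE \<omega> in P. f \<omega> = g \<omega>"
  shows "\<Phi> f = \<Phi> g"
proof (rule ccontr)
  have meas: "h \<in> borel_measurable P" if "h \<in> test_functionals P M" for h
    using that L2M_measurable by (auto simp: test_functionals_def Sp_def)
  have Sp_norm_eq: "Sp_norm P M p (\<lambda>\<omega>. f \<omega> - h \<omega>) = Sp_norm P M p (\<lambda>\<omega>. g \<omega> - h \<omega>)"
    if "h \<in> test_functionals P M" for h p
  proof -
    have "chaos_term P M p (\<lambda>\<omega>. f \<omega> - h \<omega>) = chaos_term P M p (\<lambda>\<omega>. g \<omega> - h \<omega>)"
      by (rule chaos_term_cong_AE[OF borel_measurable_diff[OF meas[OF f] meas[OF that]]
            borel_measurable_diff[OF meas[OF g] meas[OF that]]])
         (use eq in eventually_elim, simp)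
    then show ?thesis
      by (simp add: Sp_norm_def)
  qed
  have indist: "f \<in> U \<longleftrightarrow> g \<in> U" if "openin (test_topology P M) U" for U
  proof -
    have "generate_topology_on
      {{\<eta> \<in> test_functionals P M. Sp_norm P M p (\<lambda>\<omega>. \<eta> \<omega> - \<xi> \<omega>) < r} | p \<xi> r.
        0 \<le> p \<and> \<xi> \<in> test_functionals P M \<and> 0 < r} U"
      using that by (simp add: test_topology_def openin_topology_generated_by_iff)
    then show ?thesis
    proof induction
      case (Basis s)
      then show ?case using f g Sp_norm_eq by auto
    qed blast+
  qed
  have cont: "continuous_map (test_topology P M) euclidean \<Phi>"
    using \<Phi> by (simp add: generalized_functionals_def)
  have "openin (test_topology P M)
      {\<eta> \<in> test_functionals P M. Sp_norm P M 0 (\<lambda>\<omega>. \<eta> \<omega> - f \<omega>) < 1}"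
    unfolding test_topology_def using f
    by (intro topology_generated_by_Basis CollectI exI[of _ 0] exI[of _ f] exI[of _ 1]) auto
  moreover have "f \<in> {\<eta> \<in> test_functionals P M. Sp_norm P M 0 (\<lambda>\<omega>. \<eta> \<omega> - f \<omega>) < 1}"
    using f by (simp add: Sp_norm_def chaos_term_def L2_inner_def)
  ultimately have ft: "f \<in> topspace (test_topology P M)"
    using openin_subset by blast
  then have gt: "g \<in> topspace (test_topology P M)"
    using indist openin_topspace by blast
  have "openin (test_topology P M)
      {x \<in> topspace (test_topology P M). \<Phi> x \<in> - {\<Phi> g}}"
    using cont by (rule openin_continuous_map_preimage) auto
  moreover assume "\<Phi> f \<noteq> \<Phi> g"
  ultimately show False
    using indist ft gt by fastforce
qed

end

theory Submission
  imports Defs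
begin

text \<open>In terms of the chaos coefficients \<open>\<langle>Z\<^sub>\<sigma>, \<xi>\<rangle>\<close>, the space of test functionals is a space of rapidly
  decreasing families on \<open>\<Gamma>\<close>: \<open>\<parallel>\<xi>\<parallel>\<^sub>p\<close> is the \<open>\<ell>\<^sup>2\<close>-norm of \<open>\<lambda>\<^sub>\<sigma>\<^sup>p \<langle>Z\<^sub>\<sigma>, \<xi>\<rangle>\<close>. Continuous functionals
  on it therefore correspond to families of polynomial growth in \<open>\<lambda>\<^sub>\<sigma>\<close>.

  If \<open>\<Phi>\<close> is continuous, then it is bounded by 1 on some ball \<open>\<parallel>\<eta>\<parallel>\<^sub>p < r\<close>: the norms increase with \<open>p\<close>
  because \<open>\<lambda>\<^sub>\<sigma> \<ge> 1\<close>, so that finitely many of the generating balls always contain a single smaller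
  one (\<open>test_topology_contains_ball\<close>). Since \<open>\<parallel>Z\<^sub>\<sigma>\<parallel>\<^sub>p = \<lambda>\<^sub>\<sigma>\<^sup>p\<close>, evaluating \<open>\<Phi>\<close> at the multiple of \<open>Z\<^sub>\<sigma>\<close> that
  has norm \<open>r / 2\<close> gives the growth bound (\<open>Fock_transform_bound\<close>).

  Conversely, if \<open>|F \<sigma>| \<le> C \<lambda>\<^sub>\<sigma>\<^sup>p\<close>, the functional \<open>\<xi> \<mapsto> \<Sum>\<^sub>\<sigma> F \<sigma> \<langle>Z\<^sub>\<sigma>, \<xi>\<rangle>\<close> has Fock transform \<open>F\<close> by
  orthonormality of the \<open>Z\<^sub>\<sigma>\<close>. By Cauchy-Schwarz it is bounded by a multiple of \<open>\<parallel>\<xi>\<parallel>\<^sub>p\<^sub>+\<^sub>1\<close>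
  (\<open>dual_pairing_bound\<close>); the one additional power of \<open>\<lambda>\<close> is paid for by the convergence of
  \<open>\<Sum>\<^sub>\<sigma> \<lambda>\<^sub>\<sigma>\<^sup>-\<^sup>2 = \<Prod>\<^sub>k (1 + (k + 1)\<^sup>-\<^sup>2)\<close> (\<open>lam_inverse_squares_summable\<close>).

  Both directions use that the \<open>Z\<^sub>\<sigma>\<close> are orthonormal elements of \<open>\<L>\<^sup>2(M)\<close>, which follows from the
  martingale conditions by conditioning on the past of the largest index involved.\<close>

section \<open>Square-summable families\<close>

text \<open>Minkowski's inequality for infinite sums, obtained from the finite one: the partial sums
  of \<open>(norm (f x + g x))\<^sup>2\<close> are bounded by the square of the right-hand side.\<close>

lemma square_summable_add:
  fixes f g :: "'b \<Rightarrow> 'c::real_normed_vector"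
  assumes f: "(\<lambda>x. (norm (f x))\<^sup>2) summable_on A" and g: "(\<lambda>x. (norm (g x))\<^sup>2) summable_on A"
  shows "(\<lambda>x. (norm (f x + g x))\<^sup>2) summable_on A"
    and "sqrt (\<Sum>\<^sub>\<infinity>x\<in>A. (norm (f x + g x))\<^sup>2)
      \<le> sqrt (\<Sum>\<^sub>\<infinity>x\<in>A. (norm (f x))\<^sup>2) + sqrt (\<Sum>\<^sub>\<infinity>x\<in>A. (norm (g x))\<^sup>2)" (is "_ \<le> ?b")
proof -
  have b: "(\<Sum>x\<in>B. (norm (f x + g x))\<^sup>2) \<le> ?b\<^sup>2" if B: "finite B" "B \<subseteq> A" for B
  proof -
    have "sqrt (\<Sum>x\<in>B. (norm (f x + g x))\<^sup>2) \<le> L2_set (\<lambda>x. norm (f x) + norm (g x)) B"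
      unfolding L2_set_def
      by (intro real_sqrt_le_mono sum_mono power_mono norm_triangle_ineq) auto
    also have "\<dots> \<le> L2_set (\<lambda>x. norm (f x)) B + L2_set (\<lambda>x. norm (g x)) B"
      by (rule L2_set_triangle_ineq)
    also have "\<dots> \<le> ?b"
      unfolding L2_set_def using B
      by (intro add_mono real_sqrt_le_mono finite_sum_le_infsum f g) auto
    finally show ?thesis
      by (rule sqrt_le_D)
  qed
  show *: "(\<lambda>x. (norm (f x + g x))\<^sup>2) summable_on A"
    by (rule nonneg_bdd_above_summable_on) (auto intro!: bdd_aboveI2 b)
  show "sqrt (\<Sum>\<^sub>\<infinity>x\<in>A. (norm (f x + g x))\<^sup>2) \<le> ?b"
    using infsum_le_finite_sums[OF * b] by (rule real_le_lsqrt[rotated]) (auto intro!: infsum_nonneg add_nonneg_nonneg)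
qed

text \<open>The Cauchy-Schwarz inequality for infinite sums, again by way of finite partial sums.\<close>

lemma square_summable_mult:
  fixes f g :: "'b \<Rightarrow> real"
  assumes f: "(\<lambda>x. (f x)\<^sup>2) summable_on A" and g: "(\<lambda>x. (g x)\<^sup>2) summable_on A"
  shows "(\<lambda>x. \<bar>f x\<bar> * \<bar>g x\<bar>) summable_on A"
    and "(\<Sum>\<^sub>\<infinity>x\<in>A. \<bar>f x\<bar> * \<bar>g x\<bar>)
      \<le> sqrt (\<Sum>\<^sub>\<infinity>x\<in>A. (f x)\<^sup>2) * sqrt (\<Sum>\<^sub>\<infinity>x\<in>A. (g x)\<^sup>2)" (is "_ \<le> ?b")
proof -
  have b: "(\<Sum>x\<in>B. \<bar>f x\<bar> * \<bar>g x\<bar>) \<le> ?b" if B: "finite B" "B \<subseteq> A" for B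
  proof -
    have "(\<Sum>x\<in>B. \<bar>f x\<bar> * \<bar>g x\<bar>) \<le> L2_set f B * L2_set g B"
      by (rule L2_set_mult_ineq)
    also have "\<dots> \<le> ?b"
      unfolding L2_set_def using B
      by (intro mult_mono real_sqrt_le_mono finite_sum_le_infsum f g)
         (auto intro!: infsum_nonneg sum_nonneg)
    finally show ?thesis .
  qed
  show *: "(\<lambda>x. \<bar>f x\<bar> * \<bar>g x\<bar>) summable_on A"
    by (rule nonneg_bdd_above_summable_on) (auto intro!: bdd_aboveI2 b)
  show "(\<Sum>\<^sub>\<infinity>x\<in>A. \<bar>f x\<bar> * \<bar>g x\<bar>) \<le> ?b"
    using * b by (rule infsum_le_finite_sums)
qed

section \<open>The weights\<close>

lemma lam_ge_1: "1 \<le> lam \<sigma>"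
  unfolding lam_def by (rule prod_ge_1) auto

lemma lam_pos: "0 < lam \<sigma>"
  using lam_ge_1[of \<sigma>] by linarith

lemma lam_powr_double: "lam \<sigma> powr (2 * p) = (lam \<sigma> powr p)\<^sup>2"
  by (simp add: power2_eq_square flip: powr_add)

text \<open>Expanding the product \<open>\<Prod>k<n. (1 + a k)\<close> with \<open>a k = (k + 1)\<^sup>-\<^sup>2\<close> gives exactly the sum of the
  \<open>\<lambda>\<^sub>\<sigma>\<^sup>-\<^sup>2\<close> over the subsets \<open>\<sigma>\<close> of \<open>{..<n}\<close>, and the product is at most \<open>exp (\<Sum>k. a k)\<close>. Every
  finite subfamily of \<open>\<Gamma>\<close> consists of subsets of one such initial segment.\<close>

lemma lam_inverse_squares_summable: "(\<lambda>\<sigma>. (lam \<sigma> powr - 1)\<^sup>2) summable_on \<Gamma>"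
proof (rule nonneg_bdd_above_summable_on)
  let ?a = "\<lambda>k. inverse ((real (Suc k))\<^sup>2)"
  have a: "summable ?a"
    using inverse_power_summable[of 2, where 'a=real]
    by (subst summable_Suc_iff[of "\<lambda>k. inverse ((real k)\<^sup>2)"]) simp
  show "bdd_above (sum (\<lambda>\<sigma>. (lam \<sigma> powr - 1)\<^sup>2) ` {A. A \<subseteq> \<Gamma> \<and> finite A})"
  proof (rule bdd_aboveI2)
    fix A assume "A \<in> {A. A \<subseteq> \<Gamma> \<and> finite A}"
    then have A: "finite A" "\<And>\<sigma>. \<sigma> \<in> A \<Longrightarrow> finite \<sigma>"
      by (auto simp: \<Gamma>_def)
    then have "finite (\<Union>A)"
      by auto
    then obtain n where "\<Union>A \<subseteq> {..<n}"
      using finite_nat_iff_bounded by blast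
    then have AP: "A \<subseteq> Pow {..<n}"
      by auto
    have "(\<Sum>\<sigma>\<in>A. (lam \<sigma> powr - 1)\<^sup>2) \<le> (\<Sum>\<sigma>\<in>Pow {..<n}. (lam \<sigma> powr - 1)\<^sup>2)"
      by (rule sum_mono2[OF _ AP]) auto
    also have "\<dots> = (\<Sum>\<sigma>\<in>Pow {..<n}. (\<Prod>k\<in>\<sigma>. ?a k) * (\<Prod>k\<in>{..<n} - \<sigma>. 1))"
      using lam_pos
      by (intro sum.cong refl)
         (simp add: powr_minus lam_def power_inverse prod_power_distrib add.commute flip: prod_inversef)
    also have "\<dots> = (\<Prod>k<n. ?a k + 1)"
      by (rule prod_add[symmetric]) simp
    also have "\<dots> \<le> (\<Prod>k<n. exp (?a k))"
      by (intro prod_mono) (use exp_ge_add_one_self in \<open>auto simp: add.commute\<close>)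
    also have "\<dots> = exp (\<Sum>k<n. ?a k)"
      by (simp add: exp_sum)
    also have "\<dots> \<le> exp (suminf ?a)"
      using sum_le_suminf[OF a, of "{..<n}"] by simp
    finally show "(\<Sum>\<sigma>\<in>A. (lam \<sigma> powr - 1)\<^sup>2) \<le> exp (suminf ?a)" .
  qed
qed auto

section \<open>Orthonormality of the products of noises\<close>

lemma integrable_mult_of_squares:
  fixes f g :: "'a \<Rightarrow> real"
  assumes [measurable]: "f \<in> borel_measurable N" "g \<in> borel_measurable N"
    and "integrable N (\<lambda>x. (f x)\<^sup>2)" "integrable N (\<lambda>x. (g x)\<^sup>2)"
  shows "integrable N (\<lambda>x. f x * g x)"
proof (rule Bochner_Integration.integrable_bound)
  show "integrable N (\<lambda>x. (f x)\<^sup>2 + (g x)\<^sup>2)"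
    using assms by auto
  have "\<bar>a * b\<bar> \<le> a\<^sup>2 + b\<^sup>2" for a b :: real
  proof -
    have "2 * \<bar>a * b\<bar> \<le> a\<^sup>2 + b\<^sup>2"
      using sum_squares_bound[of "\<bar>a\<bar>" "\<bar>b\<bar>"] by (simp add: abs_mult mult.assoc)
    then show ?thesis
      using abs_ge_zero[of "a * b"] by linarith
  qed
  then show "AE x in N. norm (f x * g x) \<le> norm ((f x)\<^sup>2 + (g x)\<^sup>2)"
    by auto
qed auto

text \<open>Pulling \<open>f\<close> out of the conditional expectation of \<open>f * g\<close> normally presupposes that the
  product is integrable. For nonnegative functions this can be concluded instead, by computing the
  integral with the \<open>ennreal\<close>-valued conditional expectation. In this way square integrability of
  \<open>Z\<^sub>\<sigma>\<close> is propagated from one factor to the next.\<close>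

lemma (in sigma_finite_subalgebra) integrable_mult_cond_exp_1:
  fixes f g :: "'a \<Rightarrow> real"
  assumes f: "f \<in> borel_measurable F" "integrable M f" "\<And>x. 0 \<le> f x"
    and g[measurable]: "g \<in> borel_measurable M" and g0: "\<And>x. 0 \<le> g x"
    and one: "AE x in M. real_cond_exp M F g x = 1"
  shows "integrable M (\<lambda>x. f x * g x)" and "(\<integral>x. f x * g x \<partial>M) = (\<integral>x. f x \<partial>M)"
proof -
  note [measurable] = f(1) measurable_from_subalg[OF subalg f(1)]
  have "AE x in M. nn_cond_exp M F (\<lambda>x. ennreal (- g x)) x = 0"
    using nn_cond_exp_F_meas[of "\<lambda>x. ennreal (- g x)"] g0 by (simp add: ennreal_neg)
  with one have nn1: "AE x in M. nn_cond_exp M F (\<lambda>x. ennreal (g x)) x = 1"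
  proof eventually_elim
    case (elim x)
    then have "enn2real (nn_cond_exp M F (\<lambda>x. ennreal (g x)) x) = 1"
      by (simp add: real_cond_exp_def)
    \<comment> \<open>The value \<open>\<infinity>\<close> is excluded because \<open>enn2real\<close> maps it to 0.\<close>
    then show ?case
      by (cases "nn_cond_exp M F (\<lambda>x. ennreal (g x)) x") auto
  qed
  have "(\<integral>\<^sup>+x. ennreal (f x * g x) \<partial>M) = (\<integral>\<^sup>+x. ennreal (f x) * ennreal (g x) \<partial>M)"
    by (simp add: ennreal_mult f(3) g0)
  also have "\<dots> = (\<integral>\<^sup>+x. ennreal (f x) * nn_cond_exp M F (\<lambda>x. ennreal (g x)) x \<partial>M)"
    by (rule nn_cond_exp_intg[symmetric]) measurable
  also have "\<dots> = (\<integral>\<^sup>+x. ennreal (f x) \<partial>M)"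
    by (rule nn_integral_cong_AE) (use nn1 in eventually_elim, simp)
  also have "\<dots> = ennreal (\<integral>x. f x \<partial>M)"
    by (rule nn_integral_eq_integral[OF f(2)]) (simp add: f(3))
  finally have eq: "(\<integral>\<^sup>+x. ennreal (f x * g x) \<partial>M) = ennreal (\<integral>x. f x \<partial>M)" .
  show fg: "integrable M (\<lambda>x. f x * g x)"
    by (rule integrableI_nn_integral_finite[OF _ _ eq]) (use f(3) g0 in auto)
  show "(\<integral>x. f x * g x \<partial>M) = (\<integral>x. f x \<partial>M)"
    by (rule integral_eq_nn_integral[THEN trans]) (use f(3) g0 eq in auto)
qed

context normal_martingale
begin

text \<open>\<open>past n\<close> is \<open>\<F>\<^sub>n\<^sub>-\<^sub>1\<close>; indexing by \<open>{..<n}\<close> includes the trivial \<open>\<F>\<^sub>-\<^sub>1\<close> at \<open>n = 0\<close>.\<close>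

abbreviation past :: "nat \<Rightarrow> 'a measure" where
  "past n \<equiv> process_sigma P M {..<n}"

lemma sigma_finite_process_sigma: "sigma_finite_subalgebra P (process_sigma P M K)"
  using subalgebra_process_sigma finite_measure_axioms
  by (intro finite_measure_subalgebra_is_sigma_finite)
     (simp add: finite_measure_subalgebra_def finite_measure_subalgebra_axioms_def)

lemma M_measurable_process_sigma:
  assumes "k \<in> K"
  shows "M k \<in> borel_measurable (process_sigma P M K)"
proof (rule measurableI)
  fix B :: "real set" assume "B \<in> sets borel"
  then have "M k -` B \<inter> space P \<in> {M k -` B \<inter> space P | k B. k \<in> K \<and> B \<in> sets borel}"
    using assms by blast
  then show "M k -` B \<inter> space (process_sigma P M K) \<in> sets (process_sigma P M K)"
    unfolding space_process_sigma
    unfolding process_sigma_def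
    by (subst sets_measure_of) auto
qed simp

lemma noise_measurable_process_sigma:
  assumes "{..n} \<subseteq> K"
  shows "noise M n \<in> borel_measurable (process_sigma P M K)"
proof (cases n)
  case 0
  then show ?thesis
    using M_measurable_process_sigma[of 0 K] assms by (simp add: noise_def[abs_def])
next
  case (Suc m)
  then show ?thesis
    using borel_measurable_diff[OF M_measurable_process_sigma[of "Suc m" K]
        M_measurable_process_sigma[of m K]] assms
    by (simp add: noise_def[abs_def] subset_iff)
qed

lemma noise_measurable [measurable]: "noise M n \<in> borel_measurable P"
  using measurable_from_subalg[OF subalgebra_process_sigma noise_measurable_process_sigma[of n UNIV]]
  by simp

lemma integrable_M: "integrable P (M n)"
  using square_integrable_imp_integrable[OF measurable_M square_integrable_M] .

lemma integrable_M_mult: "integrable P (\<lambda>\<omega>. M m \<omega> * M n \<omega>)"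
  by (intro integrable_mult_of_squares measurable_M square_integrable_M)

lemma integrable_noise_square: "integrable P (\<lambda>\<omega>. (noise M n \<omega>)\<^sup>2)"
proof (cases n)
  case 0
  then show ?thesis
    using square_integrable_M[of 0] by (simp add: noise_def)
next
  case (Suc m)
  have "integrable P (\<lambda>\<omega>. (M n \<omega>)\<^sup>2 + (M m \<omega>)\<^sup>2 - 2 * (M n \<omega> * M m \<omega>))"
    by (intro Bochner_Integration.integrable_add Bochner_Integration.integrable_diff
        integrable_mult_right integrable_M_mult square_integrable_M)
  then show ?thesis
    by (simp add: Suc noise_def power2_diff mult.assoc)
qed

lemma cond_exp_noise: "AE \<omega> in P. real_cond_exp P (past n) (noise M n) \<omega> = 0"
proof (cases n)
  case 0
  then show ?thesis
    using cond_exp_0 by (simp add: noise_def[abs_def])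
next
  case (Suc m)
  interpret sigma_finite_subalgebra P "past n"
    by (rule sigma_finite_process_sigma)
  have "AE \<omega> in P. real_cond_exp P (past n) (\<lambda>\<omega>. M n \<omega> - M m \<omega>) \<omega>
      = real_cond_exp P (past n) (M n) \<omega> - real_cond_exp P (past n) (M m) \<omega>"
    by (intro real_cond_exp_diff integrable_M)
  moreover have "AE \<omega> in P. real_cond_exp P (past n) (M m) \<omega> = M m \<omega>"
    by (intro real_cond_exp_F_meas integrable_M M_measurable_process_sigma) (simp add: Suc)
  moreover have "AE \<omega> in P. real_cond_exp P (past n) (M n) \<omega> = M m \<omega>"
    using cond_exp_Suc[of m] by (simp add: Suc lessThan_Suc_atMost)
  ultimately have "AE \<omega> in P. real_cond_exp P (past n) (\<lambda>\<omega>. M n \<omega> - M m \<omega>) \<omega> = 0"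
    by eventually_elim simp
  then show ?thesis
    by (simp add: Suc noise_def[abs_def])
qed

lemma cond_exp_noise_square: "AE \<omega> in P. real_cond_exp P (past n) (\<lambda>\<omega>. (noise M n \<omega>)\<^sup>2) \<omega> = 1"
proof (cases n)
  case 0
  then show ?thesis
    using cond_exp_square_0 by (simp add: noise_def[abs_def])
next
  case (Suc m)
  interpret sigma_finite_subalgebra P "past n"
    by (rule sigma_finite_process_sigma)
  have Mm: "M m \<in> borel_measurable (past n)"
    by (rule M_measurable_process_sigma) (simp add: Suc)
  \<comment> \<open>\<open>(M\<^sub>n - M\<^sub>m)\<^sup>2 = M\<^sub>n\<^sup>2 - M\<^sub>m (2 M\<^sub>n - M\<^sub>m)\<close>, with \<open>M\<^sub>m\<close> measurable with respect to the past.\<close>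
  have "AE \<omega> in P. real_cond_exp P (past n) (\<lambda>\<omega>. (M n \<omega>)\<^sup>2 - M m \<omega> * (2 * M n \<omega> - M m \<omega>)) \<omega>
      = real_cond_exp P (past n) (\<lambda>\<omega>. (M n \<omega>)\<^sup>2) \<omega>
        - real_cond_exp P (past n) (\<lambda>\<omega>. M m \<omega> * (2 * M n \<omega> - M m \<omega>)) \<omega>"
  proof (intro real_cond_exp_diff square_integrable_M)
    have "integrable P (\<lambda>\<omega>. 2 * (M m \<omega> * M n \<omega>) - M m \<omega> * M m \<omega>)"
      by (intro Bochner_Integration.integrable_diff integrable_mult_right integrable_M_mult)
    then show "integrable P (\<lambda>\<omega>. M m \<omega> * (2 * M n \<omega> - M m \<omega>))"
      by (simp add: algebra_simps)
  qed
  moreover have "AE \<omega> in P. real_cond_exp P (past n) (\<lambda>\<omega>. M m \<omega> * (2 * M n \<omega> - M m \<omega>)) \<omega>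
      = M m \<omega> * real_cond_exp P (past n) (\<lambda>\<omega>. 2 * M n \<omega> - M m \<omega>) \<omega>"
  proof (intro real_cond_exp_mult Mm)
    have "integrable P (\<lambda>\<omega>. 2 * (M m \<omega> * M n \<omega>) - M m \<omega> * M m \<omega>)"
      by (intro Bochner_Integration.integrable_diff integrable_mult_right integrable_M_mult)
    then show "integrable P (\<lambda>\<omega>. M m \<omega> * (2 * M n \<omega> - M m \<omega>))"
      by (simp add: algebra_simps)
  qed (use measurable_M in measurable)
  moreover have "AE \<omega> in P. real_cond_exp P (past n) (\<lambda>\<omega>. 2 * M n \<omega> - M m \<omega>) \<omega>
      = real_cond_exp P (past n) (\<lambda>\<omega>. 2 * M n \<omega>) \<omega> - real_cond_exp P (past n) (M m) \<omega>"
    by (intro real_cond_exp_diff integrable_mult_right integrable_M)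
  moreover have "AE \<omega> in P. real_cond_exp P (past n) (\<lambda>\<omega>. 2 * M n \<omega>) \<omega>
      = 2 * real_cond_exp P (past n) (M n) \<omega>"
    by (intro real_cond_exp_cmult integrable_M)
  moreover have "AE \<omega> in P. real_cond_exp P (past n) (M m) \<omega> = M m \<omega>"
    by (intro real_cond_exp_F_meas integrable_M Mm)
  moreover have "AE \<omega> in P. real_cond_exp P (past n) (M n) \<omega> = M m \<omega>"
    using cond_exp_Suc[of m] by (simp add: Suc lessThan_Suc_atMost)
  moreover have "AE \<omega> in P. real_cond_exp P (past n) (\<lambda>\<omega>. (M n \<omega>)\<^sup>2) \<omega> = (M m \<omega>)\<^sup>2 + 1"
    using cond_exp_square_Suc[of m] by (simp add: Suc lessThan_Suc_atMost)
  ultimately have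
    "AE \<omega> in P. real_cond_exp P (past n) (\<lambda>\<omega>. (M n \<omega>)\<^sup>2 - M m \<omega> * (2 * M n \<omega> - M m \<omega>)) \<omega> = 1"
    by eventually_elim (simp add: power2_eq_square)
  moreover have "(\<lambda>\<omega>. (M n \<omega>)\<^sup>2 - M m \<omega> * (2 * M n \<omega> - M m \<omega>)) = (\<lambda>\<omega>. (noise M n \<omega>)\<^sup>2)"
    by (auto simp: Suc noise_def power2_eq_square algebra_simps)
  ultimately show ?thesis
    by simp
qed

text \<open>The real-valued version of \<open>Z\<^sub>\<sigma>\<close>, for which conditional expectations are defined.\<close>

abbreviation noise_prod :: "nat set \<Rightarrow> 'a \<Rightarrow> real" where
  "noise_prod \<sigma> \<omega> \<equiv> \<Prod>i\<in>\<sigma>. noise M i \<omega>"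

lemma noise_prod_measurable_past:
  assumes "\<sigma> \<subseteq> {..<n}"
  shows "noise_prod \<sigma> \<in> borel_measurable (past n)"
  using assms by (intro borel_measurable_prod noise_measurable_process_sigma) auto

lemma noise_prod_measurable [measurable]: "noise_prod \<sigma> \<in> borel_measurable P"
  by measurable

text \<open>Adding a new largest index \<open>n\<close> to \<open>\<sigma>\<close> multiplies the square by \<open>Z\<^sub>n\<^sup>2\<close>, whose conditional
  expectation given the past is 1, while the square of the old product is measurable with respect to
  that past.\<close>

lemma noise_prod_square_moment:
  assumes "finite \<sigma>"
  shows "integrable P (\<lambda>\<omega>. (noise_prod \<sigma> \<omega>)\<^sup>2) \<and> (\<integral>\<omega>. (noise_prod \<sigma> \<omega>)\<^sup>2 \<partial>P) = 1"
  using assms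
proof (induction rule: finite_linorder_max_induct)
  case empty
  then show ?case
    by (simp add: prob_space)
next
  case (insert n \<sigma>)
  interpret sigma_finite_subalgebra P "past n"
    by (rule sigma_finite_process_sigma)
  have "\<sigma> \<subseteq> {..<n}" "n \<notin> \<sigma>"
    using insert.hyps by auto
  then have *: "(noise_prod (insert n \<sigma>) \<omega>)\<^sup>2 = (noise_prod \<sigma> \<omega>)\<^sup>2 * (noise M n \<omega>)\<^sup>2" for \<omega>
    using insert.hyps(1) by (simp add: power_mult_distrib mult.commute)
  have "(\<lambda>\<omega>. (noise_prod \<sigma> \<omega>)\<^sup>2) \<in> borel_measurable (past n)"
    using noise_prod_measurable_past[OF \<open>\<sigma> \<subseteq> {..<n}\<close>] by measurable
  then show ?case
    unfolding *
    using integrable_mult_cond_exp_1[of "\<lambda>\<omega>. (noise_prod \<sigma> \<omega>)\<^sup>2" "\<lambda>\<omega>. (noise M n \<omega>)\<^sup>2"]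
      cond_exp_noise_square insert.IH by simp
qed

lemma noise_prod_mult_integrable:
  assumes "finite \<sigma>" "finite \<tau>"
  shows "integrable P (\<lambda>\<omega>. noise_prod \<sigma> \<omega> * noise_prod \<tau> \<omega>)"
  using assms noise_prod_square_moment by (intro integrable_mult_of_squares noise_prod_measurable) auto

text \<open>If the largest index occurs in only one of the two products, its noise is a factor with
  conditional expectation 0 given the remaining factors.\<close>

lemma noise_prod_orthogonal_max:
  assumes "finite \<sigma>" "finite \<tau>" "\<sigma> \<subseteq> {..<n}" "\<tau> \<subseteq> {..<n}"
  shows "(\<integral>\<omega>. noise_prod (insert n \<sigma>) \<omega> * noise_prod \<tau> \<omega> \<partial>P) = 0"
proof -
  interpret sigma_finite_subalgebra P "past n"
    by (rule sigma_finite_process_sigma)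
  have "n \<notin> \<sigma>"
    using assms by auto
  then have *: "noise_prod (insert n \<sigma>) \<omega> * noise_prod \<tau> \<omega> = (noise_prod \<sigma> \<omega> * noise_prod \<tau> \<omega>) * noise M n \<omega>" for \<omega>
    using assms(1) by simp
  have "(\<integral>\<omega>. (noise_prod \<sigma> \<omega> * noise_prod \<tau> \<omega>) * noise M n \<omega> \<partial>P)
      = (\<integral>\<omega>. (noise_prod \<sigma> \<omega> * noise_prod \<tau> \<omega>) * real_cond_exp P (past n) (noise M n) \<omega> \<partial>P)"
  proof (rule real_cond_exp_intg(2)[symmetric])
    show "integrable P (\<lambda>\<omega>. (noise_prod \<sigma> \<omega> * noise_prod \<tau> \<omega>) * noise M n \<omega>)"
      using noise_prod_mult_integrable[of "insert n \<sigma>" \<tau>] assms unfolding * by simp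
    show "(\<lambda>\<omega>. noise_prod \<sigma> \<omega> * noise_prod \<tau> \<omega>) \<in> borel_measurable (past n)"
      using assms noise_prod_measurable_past by (intro borel_measurable_times) auto
  qed simp
  also have "\<dots> = (\<integral>\<omega>. 0 \<partial>P)"
  proof (rule integral_cong_AE)
    show "AE \<omega> in P. (noise_prod \<sigma> \<omega> * noise_prod \<tau> \<omega>) * real_cond_exp P (past n) (noise M n) \<omega> = 0"
      using cond_exp_noise[of n] by eventually_elim simp
  qed auto
  finally show ?thesis
    by (simp add: *)
qed

text \<open>Indices are removed from the top. As long as the largest index is common to both sets, it
  contributes \<open>Z\<^sub>n\<^sup>2\<close>, of conditional expectation 1, and can be dropped; since the sets differ,
  at some stage the largest index belongs to just one of them.\<close>

lemma noise_prod_orthogonal: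
  assumes "finite \<sigma>" "finite \<tau>" "\<sigma> \<noteq> \<tau>"
  shows "(\<integral>\<omega>. noise_prod \<sigma> \<omega> * noise_prod \<tau> \<omega> \<partial>P) = 0"
proof -
  have "(\<integral>\<omega>. noise_prod \<sigma> \<omega> * noise_prod \<tau> \<omega> \<partial>P) = 0" if "\<sigma> \<subseteq> {..<n}" "\<tau> \<subseteq> {..<n}" "\<sigma> \<noteq> \<tau>" for n
    using that
  proof (induction n arbitrary: \<sigma> \<tau>)
    case 0
    then show ?case
      by simp
  next
    case (Suc n)
    define \<sigma>' \<tau>' where "\<sigma>' = \<sigma> - {n}" and "\<tau>' = \<tau> - {n}"
    have sub: "\<sigma>' \<subseteq> {..<n}" "\<tau>' \<subseteq> {..<n}"
      using Suc.prems by (auto simp: \<sigma>'_def \<tau>'_def lessThan_Suc)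
    then have fin: "finite \<sigma>'" "finite \<tau>'"
      using finite_subset by blast+
    have \<sigma>: "\<sigma> = (if n \<in> \<sigma> then insert n \<sigma>' else \<sigma>')" and \<tau>: "\<tau> = (if n \<in> \<tau> then insert n \<tau>' else \<tau>')"
      by (auto simp: \<sigma>'_def \<tau>'_def)
    consider "n \<notin> \<sigma>" "n \<notin> \<tau>" | "n \<in> \<sigma>" "n \<notin> \<tau>" | "n \<notin> \<sigma>" "n \<in> \<tau>" | "n \<in> \<sigma>" "n \<in> \<tau>"
      by blast
    then show ?case
    proof cases
      case 1
      then show ?thesis
        using Suc.IH[of \<sigma> \<tau>] Suc.prems \<sigma> \<tau> sub by metis
    next
      case 2
      then show ?thesis
        using noise_prod_orthogonal_max[OF fin sub] \<sigma> \<tau> by metis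
    next
      case 3
      then have "(\<integral>\<omega>. noise_prod \<tau> \<omega> * noise_prod \<sigma> \<omega> \<partial>P) = 0"
        using noise_prod_orthogonal_max[OF fin(2,1) sub(2,1)] \<sigma> \<tau> by metis
      moreover have "(\<lambda>\<omega>. noise_prod \<sigma> \<omega> * noise_prod \<tau> \<omega>) = (\<lambda>\<omega>. noise_prod \<tau> \<omega> * noise_prod \<sigma> \<omega>)"
        by (intro ext mult.commute)
      ultimately show ?thesis
        by (simp only:)
    next
      case 4
      interpret sigma_finite_subalgebra P "past n"
        by (rule sigma_finite_process_sigma)
      have "n \<notin> \<sigma>'" "n \<notin> \<tau>'"
        by (auto simp: \<sigma>'_def \<tau>'_def)
      then have *: "noise_prod (insert n \<sigma>') \<omega> * noise_prod (insert n \<tau>') \<omega> = (noise_prod \<sigma>' \<omega> * noise_prod \<tau>' \<omega>) * (noise M n \<omega>)\<^sup>2" for \<omega>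
        using fin by (simp add: power2_eq_square)
      have "(\<integral>\<omega>. (noise_prod \<sigma>' \<omega> * noise_prod \<tau>' \<omega>) * (noise M n \<omega>)\<^sup>2 \<partial>P)
          = (\<integral>\<omega>. (noise_prod \<sigma>' \<omega> * noise_prod \<tau>' \<omega>) * real_cond_exp P (past n) (\<lambda>\<omega>. (noise M n \<omega>)\<^sup>2) \<omega> \<partial>P)"
      proof (rule real_cond_exp_intg(2)[symmetric])
        show "integrable P (\<lambda>\<omega>. (noise_prod \<sigma>' \<omega> * noise_prod \<tau>' \<omega>) * (noise M n \<omega>)\<^sup>2)"
          using noise_prod_mult_integrable[of "insert n \<sigma>'" "insert n \<tau>'"] fin unfolding * by simp
        show "(\<lambda>\<omega>. noise_prod \<sigma>' \<omega> * noise_prod \<tau>' \<omega>) \<in> borel_measurable (past n)"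
          using sub noise_prod_measurable_past by (intro borel_measurable_times) auto
      qed simp
      also have "\<dots> = (\<integral>\<omega>. noise_prod \<sigma>' \<omega> * noise_prod \<tau>' \<omega> \<partial>P)"
      proof (rule integral_cong_AE)
        show "AE \<omega> in P. (noise_prod \<sigma>' \<omega> * noise_prod \<tau>' \<omega>) * real_cond_exp P (past n) (\<lambda>\<omega>. (noise M n \<omega>)\<^sup>2) \<omega>
            = noise_prod \<sigma>' \<omega> * noise_prod \<tau>' \<omega>"
          using cond_exp_noise_square[of n] by eventually_elim simp
      qed auto
      also have "\<dots> = 0"
        using sub Suc.prems(3) 4 \<sigma> \<tau> by (intro Suc.IH) auto
      finally have "(\<integral>\<omega>. noise_prod (insert n \<sigma>') \<omega> * noise_prod (insert n \<tau>') \<omega> \<partial>P) = 0"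
        by (simp only: *)
      then show ?thesis
        using 4 \<sigma> \<tau> by (metis)
    qed
  qed
  moreover have "finite (\<sigma> \<union> \<tau>)"
    using assms by simp
  then obtain n where "\<sigma> \<union> \<tau> \<subseteq> {..<n}"
    using finite_nat_iff_bounded by blast
  ultimately show ?thesis
    using assms(3) by (meson Un_subset_iff)
qed

lemma Z_orthonormal:
  assumes "finite \<sigma>" "finite \<tau>"
  shows "L2_inner P (Z M \<sigma>) (Z M \<tau>) = (if \<sigma> = \<tau> then 1 else 0)"
proof -
  have "L2_inner P (Z M \<sigma>) (Z M \<tau>) = complex_of_real (\<integral>\<omega>. noise_prod \<sigma> \<omega> * noise_prod \<tau> \<omega> \<partial>P)"
    by (simp add: L2_inner_def Z_def flip: of_real_mult of_real_prod)
  then show ?thesis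
    using assms noise_prod_orthogonal noise_prod_square_moment by (simp add: power2_eq_square)
qed

lemma Z_in_L2M:
  assumes "finite \<sigma>"
  shows "Z M \<sigma> \<in> L2M P M"
proof -
  have meas: "noise_prod \<sigma> \<in> borel_measurable (process_sigma P M UNIV)"
    by (intro borel_measurable_prod noise_measurable_process_sigma) auto
  then have Z: "Z M \<sigma> \<in> borel_measurable (process_sigma P M UNIV)"
    unfolding Z_def[abs_def] by measurable
  have eq: "(cmod (Z M \<sigma> \<omega>))\<^sup>2 = (noise_prod \<sigma> \<omega>)\<^sup>2" for \<omega>
    unfolding Z_def norm_of_real by simp
  have "(\<lambda>\<omega>. (noise_prod \<sigma> \<omega>)\<^sup>2) \<in> borel_measurable (process_sigma P M UNIV)"
    using meas by measurable
  then have "integrable (restr_to_subalg P (process_sigma P M UNIV)) (\<lambda>\<omega>. (noise_prod \<sigma> \<omega>)\<^sup>2)"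
    using noise_prod_square_moment[OF assms] by (intro integrable_in_subalg subalgebra_process_sigma) auto
  then show ?thesis
    using measurable_in_subalg[OF subalgebra_process_sigma Z] by (simp add: L2M_def L2_def eq)
qed

end

section \<open>Chaos coefficients and test functionals\<close>

context normal_martingale
begin

lemma L2M_square_integrable:
  assumes "\<xi> \<in> L2M P M"
  shows "integrable P (\<lambda>\<omega>. (cmod (\<xi> \<omega>))\<^sup>2)"
  using assms integrable_from_subalg[OF subalgebra_process_sigma]
  by (auto simp: L2M_def L2_def)

lemma L2M_add:
  assumes "\<xi> \<in> L2M P M" "\<eta> \<in> L2M P M"
  shows "(\<lambda>\<omega>. \<xi> \<omega> + \<eta> \<omega>) \<in> L2M P M"
proof -
  let ?N = "restr_to_subalg P (process_sigma P M UNIV)"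
  have [measurable]: "\<xi> \<in> borel_measurable ?N" "\<eta> \<in> borel_measurable ?N"
    and int: "integrable ?N (\<lambda>\<omega>. (cmod (\<xi> \<omega>))\<^sup>2)" "integrable ?N (\<lambda>\<omega>. (cmod (\<eta> \<omega>))\<^sup>2)"
    using assms by (auto simp: L2M_def L2_def)
  have "integrable ?N (\<lambda>\<omega>. (cmod (\<xi> \<omega> + \<eta> \<omega>))\<^sup>2)"
  proof (rule Bochner_Integration.integrable_bound)
    show "integrable ?N (\<lambda>\<omega>. 2 * (cmod (\<xi> \<omega>))\<^sup>2 + 2 * (cmod (\<eta> \<omega>))\<^sup>2)"
      using int by auto
    have "(cmod (a + b))\<^sup>2 \<le> 2 * (cmod a)\<^sup>2 + 2 * (cmod b)\<^sup>2" for a b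
    proof -
      have "(cmod (a + b))\<^sup>2 \<le> (cmod a + cmod b)\<^sup>2"
        by (intro power_mono norm_triangle_ineq) auto
      also have "\<dots> \<le> 2 * (cmod a)\<^sup>2 + 2 * (cmod b)\<^sup>2"
        using sum_squares_bound[of "cmod a" "cmod b"] by (simp add: power2_sum)
      finally show ?thesis .
    qed
    then show "AE \<omega> in ?N. norm ((cmod (\<xi> \<omega> + \<eta> \<omega>))\<^sup>2)
        \<le> norm (2 * (cmod (\<xi> \<omega>))\<^sup>2 + 2 * (cmod (\<eta> \<omega>))\<^sup>2)"
      by auto
  qed measurable
  then show ?thesis
    by (simp add: L2M_def L2_def)
qed

lemma L2M_scale:
  assumes "\<xi> \<in> L2M P M"
  shows "(\<lambda>\<omega>. c * \<xi> \<omega>) \<in> L2M P M"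
  using assms by (auto simp: L2M_def L2_def norm_mult power_mult_distrib)

lemma integrable_Z_mult:
  assumes "finite \<sigma>" "\<xi> \<in> L2M P M"
  shows "integrable P (\<lambda>\<omega>. cnj (Z M \<sigma> \<omega>) * \<xi> \<omega>)"
proof -
  have \<xi> [measurable]: "\<xi> \<in> borel_measurable P"
    using assms by (intro L2M_measurable)
  have cnj: "cnj (Z M \<sigma> \<omega>) = complex_of_real (noise_prod \<sigma> \<omega>)" for \<omega>
    unfolding Z_def by (rule complex_cnj_complex_of_real)
  have "integrable P (\<lambda>\<omega>. noise_prod \<sigma> \<omega> * cmod (\<xi> \<omega>))"
    using assms noise_prod_square_moment L2M_square_integrable
    by (intro integrable_mult_of_squares) auto
  then show ?thesis
    unfolding cnj
    by (rule Bochner_Integration.integrable_bound) (auto simp: norm_mult abs_mult simp del: of_real_prod)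
qed

lemma coefficient_add:
  assumes "finite \<sigma>" "\<xi> \<in> L2M P M" "\<eta> \<in> L2M P M"
  shows "L2_inner P (Z M \<sigma>) (\<lambda>\<omega>. \<xi> \<omega> + \<eta> \<omega>) = L2_inner P (Z M \<sigma>) \<xi> + L2_inner P (Z M \<sigma>) \<eta>"
  unfolding L2_inner_def distrib_left
  by (intro Bochner_Integration.integral_add integrable_Z_mult assms)

lemma coefficient_scale:
  "L2_inner P (Z M \<sigma>) (\<lambda>\<omega>. c * \<xi> \<omega>) = c * L2_inner P (Z M \<sigma>) \<xi>"
  unfolding L2_inner_def mult.left_commute[of _ c] by (rule integral_mult_right_zero)

text \<open>Exhibits \<open>Sp_norm P M p\<close> as the \<open>\<ell>\<^sup>2\<close>-norm of the weighted coefficients, so that the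
  inequalities for square-summable families apply.\<close>

lemma chaos_term_eq:
  "chaos_term P M p \<xi> \<sigma> = (norm (complex_of_real (lam \<sigma> powr p) * L2_inner P (Z M \<sigma>) \<xi>))\<^sup>2"
  by (simp add: chaos_term_def lam_powr_double norm_mult power_mult_distrib)

lemma chaos_term_mono:
  assumes "p \<le> q"
  shows "chaos_term P M p \<xi> \<sigma> \<le> chaos_term P M q \<xi> \<sigma>"
  unfolding chaos_term_def using assms lam_ge_1[of \<sigma>]
  by (intro mult_right_mono powr_mono) auto

lemma chaos_term_nonneg: "0 \<le> chaos_term P M p \<xi> \<sigma>"
  by (simp add: chaos_term_eq)

lemma chaos_term_add:
  assumes "\<sigma> \<in> \<Gamma>" "\<xi> \<in> L2M P M" "\<eta> \<in> L2M P M"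
  shows "chaos_term P M p (\<lambda>\<omega>. \<xi> \<omega> + \<eta> \<omega>) \<sigma>
    = (norm (complex_of_real (lam \<sigma> powr p) * L2_inner P (Z M \<sigma>) \<xi>
        + complex_of_real (lam \<sigma> powr p) * L2_inner P (Z M \<sigma>) \<eta>))\<^sup>2"
  using assms by (simp add: chaos_term_eq coefficient_add \<Gamma>_def distrib_left)

lemma chaos_term_scale: "chaos_term P M p (\<lambda>\<omega>. c * \<xi> \<omega>) \<sigma> = (cmod c)\<^sup>2 * chaos_term P M p \<xi> \<sigma>"
  by (simp add: chaos_term_eq coefficient_scale norm_mult power_mult_distrib)

text \<open>The intersection over natural \<open>p\<close> already controls every real exponent, because the terms
  increase with \<open>p\<close>.\<close>

lemma test_functionals_iff:
  "\<xi> \<in> test_functionals P M \<longleftrightarrow> \<xi> \<in> L2M P M \<and> (\<forall>p::real. chaos_term P M p \<xi> summable_on \<Gamma>)"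
proof
  assume \<xi>: "\<xi> \<in> test_functionals P M"
  show "\<xi> \<in> L2M P M \<and> (\<forall>p::real. chaos_term P M p \<xi> summable_on \<Gamma>)"
  proof (intro conjI allI)
    fix p :: real
    have "chaos_term P M (real (nat \<lceil>p\<rceil>)) \<xi> summable_on \<Gamma>"
      using \<xi> by (auto simp: test_functionals_def Sp_def)
    then show "chaos_term P M p \<xi> summable_on \<Gamma>"
      by (rule summable_on_comparison_test) (auto intro!: chaos_term_mono chaos_term_nonneg real_nat_ceiling_ge)
  qed (use \<xi> in \<open>auto simp: test_functionals_def Sp_def\<close>)
qed (auto simp: test_functionals_def Sp_def)

lemma test_functionals_add:
  assumes "\<xi> \<in> test_functionals P M" "\<eta> \<in> test_functionals P M"
  shows "(\<lambda>\<omega>. \<xi> \<omega> + \<eta> \<omega>) \<in> test_functionals P M"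
    and "Sp_norm P M p (\<lambda>\<omega>. \<xi> \<omega> + \<eta> \<omega>) \<le> Sp_norm P M p \<xi> + Sp_norm P M p \<eta>"
proof -
  have L2M: "\<xi> \<in> L2M P M" "\<eta> \<in> L2M P M"
    and summable: "chaos_term P M p \<xi> summable_on \<Gamma>" "chaos_term P M p \<eta> summable_on \<Gamma>" for p
    using assms by (auto simp: test_functionals_iff)
  have "chaos_term P M p (\<lambda>\<omega>. \<xi> \<omega> + \<eta> \<omega>) summable_on \<Gamma>" for p
    using square_summable_add(1)[OF summable[of p, unfolded chaos_term_eq[abs_def]]]
    by (subst summable_on_cong[OF chaos_term_add[OF _ L2M]])
  then show "(\<lambda>\<omega>. \<xi> \<omega> + \<eta> \<omega>) \<in> test_functionals P M"
    using L2M_add[OF L2M] by (simp add: test_functionals_iff)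
  show "Sp_norm P M p (\<lambda>\<omega>. \<xi> \<omega> + \<eta> \<omega>) \<le> Sp_norm P M p \<xi> + Sp_norm P M p \<eta>"
    using square_summable_add(2)[OF summable[of p, unfolded chaos_term_eq[abs_def]]]
    unfolding Sp_norm_def
    by (subst infsum_cong[OF chaos_term_add[OF _ L2M]]) (simp_all add: chaos_term_eq[abs_def])
qed

lemma test_functionals_scale:
  assumes "\<xi> \<in> test_functionals P M"
  shows "(\<lambda>\<omega>. c * \<xi> \<omega>) \<in> test_functionals P M"
  using assms L2M_scale
  by (auto simp: test_functionals_iff chaos_term_scale[abs_def] intro: summable_on_cmult_right)

lemma Sp_norm_scale: "Sp_norm P M p (\<lambda>\<omega>. c * \<xi> \<omega>) = cmod c * Sp_norm P M p \<xi>"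
  by (simp add: Sp_norm_def chaos_term_scale[abs_def] infsum_cmult_right' real_sqrt_mult)

lemma test_functionals_diff:
  assumes "\<xi> \<in> test_functionals P M" "\<eta> \<in> test_functionals P M"
  shows "(\<lambda>\<omega>. \<xi> \<omega> - \<eta> \<omega>) \<in> test_functionals P M"
  using test_functionals_add(1)[OF assms(1) test_functionals_scale[OF assms(2), of "-1"]] by simp

lemma Sp_norm_mono:
  assumes "\<xi> \<in> test_functionals P M" "p \<le> q"
  shows "Sp_norm P M p \<xi> \<le> Sp_norm P M q \<xi>"
  using assms unfolding Sp_norm_def
  by (intro real_sqrt_le_mono infsum_mono chaos_term_mono) (auto simp: test_functionals_iff)

lemma chaos_term_Z_has_sum:
  assumes "finite \<sigma>"
  shows "(chaos_term P M p (Z M \<sigma>) has_sum (lam \<sigma> powr p)\<^sup>2) \<Gamma>"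
  using assms
  by (intro has_sum_finite_neutralI[of "{\<sigma>}"])
     (auto simp: \<Gamma>_def chaos_term_def Z_orthonormal lam_powr_double)

lemma Z_in_test_functionals:
  assumes "finite \<sigma>"
  shows "Z M \<sigma> \<in> test_functionals P M"
  using assms chaos_term_Z_has_sum Z_in_L2M
  by (auto simp: test_functionals_iff intro: has_sum_imp_summable)

lemma Sp_norm_Z:
  assumes "finite \<sigma>"
  shows "Sp_norm P M p (Z M \<sigma>) = lam \<sigma> powr p"
  using infsumI[OF chaos_term_Z_has_sum[OF assms, of p]] by (simp add: Sp_norm_def)

lemma Sp_norm_zero: "Sp_norm P M p (\<lambda>\<omega>. 0) = 0"
  by (simp add: Sp_norm_def chaos_term_def L2_inner_def)

lemma topspace_test_topology: "topspace (test_topology P M) = test_functionals P M"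
proof -
  have "\<xi> \<in> {\<eta> \<in> test_functionals P M. Sp_norm P M 0 (\<lambda>\<omega>. \<eta> \<omega> - \<xi> \<omega>) < 1}"
    if "\<xi> \<in> test_functionals P M" for \<xi>
    using that by (simp add: Sp_norm_zero)
  then show ?thesis
    unfolding test_topology_def topology_generated_by_topspace
    by (intro equalityI subsetI) (blast, use zero_less_one in \<open>blast\<close>)
qed

lemma test_topology_ball:
  assumes "0 \<le> p" "0 < r" "\<xi> \<in> test_functionals P M"
  shows "openin (test_topology P M)
    {\<eta> \<in> test_functionals P M. Sp_norm P M p (\<lambda>\<omega>. \<eta> \<omega> - \<xi> \<omega>) < r}"
  unfolding test_topology_def using assms by (intro topology_generated_by_Basis) blast

text \<open>The generating balls have varying centres and exponents. By the triangle inequality a ball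
  can be recentred at any of its points, and the monotonicity of the norms in \<open>p\<close> lets the maximal
  exponent and the minimal radius serve for an intersection. Hence single balls centred at \<open>\<xi>\<close> form
  a neighbourhood base at \<open>\<xi>\<close>.\<close>

lemma test_topology_contains_ball:
  assumes "openin (test_topology P M) U" "\<xi> \<in> U"
  shows "\<exists>p\<ge>0. \<exists>r>0. \<forall>\<eta>\<in>test_functionals P M. Sp_norm P M p (\<lambda>\<omega>. \<eta> \<omega> - \<xi> \<omega>) < r \<longrightarrow> \<eta> \<in> U"
proof -
  have \<xi>: "\<xi> \<in> test_functionals P M"
    using assms openin_subset topspace_test_topology by blast
  have "generate_topology_on
      {{\<eta> \<in> test_functionals P M. Sp_norm P M p (\<lambda>\<omega>. \<eta> \<omega> - \<xi> \<omega>) < r} | p \<xi> r.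
        0 \<le> p \<and> \<xi> \<in> test_functionals P M \<and> 0 < r} U"
    using assms(1) by (simp add: test_topology_def openin_topology_generated_by_iff)
  then show ?thesis
    using assms(2)
  proof induction
    case Empty
    then show ?case
      by simp
  next
    case (Int U V)
    obtain p r where U: "p \<ge> 0" "r > 0"
      "\<And>\<eta>. \<eta> \<in> test_functionals P M \<Longrightarrow> Sp_norm P M p (\<lambda>\<omega>. \<eta> \<omega> - \<xi> \<omega>) < r \<Longrightarrow> \<eta> \<in> U"
      using Int by blast
    obtain q s where V: "q \<ge> 0" "s > 0"
      "\<And>\<eta>. \<eta> \<in> test_functionals P M \<Longrightarrow> Sp_norm P M q (\<lambda>\<omega>. \<eta> \<omega> - \<xi> \<omega>) < s \<Longrightarrow> \<eta> \<in> V"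
      using Int by blast
    have "\<eta> \<in> U \<inter> V"
      if \<eta>: "\<eta> \<in> test_functionals P M" "Sp_norm P M (max p q) (\<lambda>\<omega>. \<eta> \<omega> - \<xi> \<omega>) < min r s" for \<eta>
      using U(3)[OF \<eta>(1)] V(3)[OF \<eta>(1)] \<eta>(2)
        Sp_norm_mono[OF test_functionals_diff[OF \<eta>(1) \<xi>], of p "max p q"]
        Sp_norm_mono[OF test_functionals_diff[OF \<eta>(1) \<xi>], of q "max p q"]
      by simp
    then show ?case
      using U(1,2) V(1,2) by (intro exI[of _ "max p q"] conjI exI[of _ "min r s"]) auto
  next
    case (UN K)
    then show ?case
      by (meson UnionE UnionI)
  next
    case (Basis U)
    then obtain p \<zeta> r where U: "U = {\<eta> \<in> test_functionals P M. Sp_norm P M p (\<lambda>\<omega>. \<eta> \<omega> - \<zeta> \<omega>) < r}"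
      and p: "0 \<le> p" and \<zeta>: "\<zeta> \<in> test_functionals P M"
      by blast
    have "\<eta> \<in> U" if \<eta>: "\<eta> \<in> test_functionals P M"
      "Sp_norm P M p (\<lambda>\<omega>. \<eta> \<omega> - \<xi> \<omega>) < r - Sp_norm P M p (\<lambda>\<omega>. \<xi> \<omega> - \<zeta> \<omega>)" for \<eta>
      using test_functionals_add(2)[OF test_functionals_diff[OF \<eta>(1) \<xi>] test_functionals_diff[OF \<xi> \<zeta>], of p] \<eta>
      by (simp add: U)
    moreover have "0 < r - Sp_norm P M p (\<lambda>\<omega>. \<xi> \<omega> - \<zeta> \<omega>)"
      using Basis.prems by (simp add: U)
    ultimately show ?case
      using p by blast
  qed
qed

section \<open>The characterization of Fock transforms\<close>

text \<open>By continuity at 0 there is a ball \<open>\<parallel>\<eta>\<parallel>\<^sub>p < r\<close> on which \<open>|\<Phi> \<eta>| < 1\<close>. The multiple of \<open>Z\<^sub>\<sigma>\<close> with norm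
  \<open>r / 2\<close> lies in it, and homogeneity turns this into the bound \<open>2 / r * \<lambda>\<^sub>\<sigma>\<^sup>p\<close> for \<open>\<Phi> (Z\<^sub>\<sigma>)\<close>.\<close>

lemma Fock_transform_bound:
  assumes \<Phi>: "\<Phi> \<in> generalized_functionals P M"
  shows "\<exists>C p :: real. 0 \<le> C \<and> 0 \<le> p \<and> (\<forall>\<sigma>\<in>\<Gamma>. cmod (Fock_transform M \<Phi> \<sigma>) \<le> C * lam \<sigma> powr p)"
proof -
  have scale: "\<Phi> (\<lambda>\<omega>. c * \<xi> \<omega>) = c * \<Phi> \<xi>" if "\<xi> \<in> test_functionals P M" for c \<xi>
    using \<Phi> that by (simp add: generalized_functionals_def)
  have zero: "(\<lambda>\<omega>. 0) \<in> test_functionals P M" "\<Phi> (\<lambda>\<omega>. 0) = 0"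
    using test_functionals_scale[of "Z M {}" 0] scale[of "Z M {}" 0] Z_in_test_functionals[of "{}"]
    by simp_all
  define U where "U = {\<xi> \<in> topspace (test_topology P M). \<Phi> \<xi> \<in> ball 0 1}"
  have "openin (test_topology P M) U"
    unfolding U_def using \<Phi>
    by (intro openin_continuous_map_preimage) (auto simp: generalized_functionals_def)
  moreover have "(\<lambda>\<omega>. 0) \<in> U"
    using zero by (simp add: U_def topspace_test_topology)
  ultimately obtain p r where p: "0 \<le> p" and r: "0 < r"
    and ball: "\<And>\<eta>. \<eta> \<in> test_functionals P M \<Longrightarrow> Sp_norm P M p \<eta> < r \<Longrightarrow> \<eta> \<in> U"
    using test_topology_contains_ball[of U "\<lambda>\<omega>. 0"] by auto
  have "cmod (\<Phi> (Z M \<sigma>)) \<le> 2 / r * lam \<sigma> powr p" if "\<sigma> \<in> \<Gamma>" for \<sigma>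
  proof -
    define t where "t = r / (2 * lam \<sigma> powr p)"
    have t: "0 < t"
      using r lam_pos[of \<sigma>] by (simp add: t_def)
    have Z: "finite \<sigma>" "Z M \<sigma> \<in> test_functionals P M"
      using that Z_in_test_functionals by (auto simp: \<Gamma>_def)
    have "Sp_norm P M p (\<lambda>\<omega>. complex_of_real t * Z M \<sigma> \<omega>) = r / 2"
      using t lam_pos[of \<sigma>] by (simp add: Sp_norm_scale Sp_norm_Z[OF Z(1)]) (simp add: t_def)
    then have "(\<lambda>\<omega>. complex_of_real t * Z M \<sigma> \<omega>) \<in> U"
      using r by (intro ball test_functionals_scale Z) simp
    then have "t * cmod (\<Phi> (Z M \<sigma>)) < 1"
      using t by (simp add: U_def scale[OF Z(2)] norm_mult)
    then have "cmod (\<Phi> (Z M \<sigma>)) \<le> 1 / t"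
      using t by (simp add: field_simps)
    then show ?thesis
      by (simp add: t_def)
  qed
  then show ?thesis
    using p r by (intro exI[of _ "2 / r"] exI[of _ p]) (simp add: Fock_transform_def)
qed

definition dual_pairing :: "(nat set \<Rightarrow> complex) \<Rightarrow> ('a \<Rightarrow> complex) \<Rightarrow> complex" where
  "dual_pairing F \<xi> = (\<Sum>\<^sub>\<infinity>\<sigma>\<in>\<Gamma>. F \<sigma> * L2_inner P (Z M \<sigma>) \<xi>)"

text \<open>Splitting \<open>\<lambda>\<^sub>\<sigma>\<^sup>p = \<lambda>\<^sub>\<sigma>\<^sup>-\<^sup>1 \<lambda>\<^sub>\<sigma>\<^sup>p\<^sup>+\<^sup>1\<close> writes the majorant of the series as a product of the
  square-summable family \<open>\<lambda>\<^sub>\<sigma>\<^sup>-\<^sup>1\<close> and the weighted coefficients whose \<open>\<ell>\<^sup>2\<close>-norm is \<open>\<parallel>\<xi>\<parallel>\<^sub>p\<^sub>+\<^sub>1\<close>.\<close>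

lemma dual_pairing_bound:
  assumes F: "\<And>\<sigma>. \<sigma> \<in> \<Gamma> \<Longrightarrow> cmod (F \<sigma>) \<le> C * lam \<sigma> powr p"
    and \<xi>: "\<xi> \<in> test_functionals P M"
  shows "(\<lambda>\<sigma>. F \<sigma> * L2_inner P (Z M \<sigma>) \<xi>) summable_on \<Gamma>"
    and "cmod (dual_pairing F \<xi>)
      \<le> C * sqrt (\<Sum>\<^sub>\<infinity>\<sigma>\<in>\<Gamma>. (lam \<sigma> powr - 1)\<^sup>2) * Sp_norm P M (p + 1) \<xi>"
proof -
  let ?c = "\<lambda>\<sigma>. L2_inner P (Z M \<sigma>) \<xi>"
  let ?w = "\<lambda>\<sigma>. cmod (complex_of_real (lam \<sigma> powr (p + 1)) * ?c \<sigma>)"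
  let ?b = "\<lambda>\<sigma>. \<bar>lam \<sigma> powr - 1\<bar> * \<bar>?w \<sigma>\<bar>"
  have w: "(\<lambda>\<sigma>. (?w \<sigma>)\<^sup>2) summable_on \<Gamma>"
    using \<xi> by (simp add: test_functionals_iff flip: chaos_term_eq)
  have le: "cmod (F \<sigma> * ?c \<sigma>) \<le> C * ?b \<sigma>" if "\<sigma> \<in> \<Gamma>" for \<sigma>
  proof -
    have "cmod (F \<sigma> * ?c \<sigma>) \<le> C * lam \<sigma> powr p * cmod (?c \<sigma>)"
      unfolding norm_mult by (intro mult_right_mono F that) simp
    also have "lam \<sigma> powr p = lam \<sigma> powr - 1 * lam \<sigma> powr (p + 1)"
      by (subst powr_add[symmetric]) simp
    finally show ?thesis
      by (simp add: norm_mult mult.assoc)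
  qed
  have b: "?b summable_on \<Gamma>" "infsum ?b \<Gamma> \<le> sqrt (\<Sum>\<^sub>\<infinity>\<sigma>\<in>\<Gamma>. (lam \<sigma> powr - 1)\<^sup>2) * Sp_norm P M (p + 1) \<xi>"
    using square_summable_mult[OF lam_inverse_squares_summable w]
    by (simp_all add: Sp_norm_def chaos_term_eq[abs_def])
  have Cb: "(\<lambda>\<sigma>. C * ?b \<sigma>) summable_on \<Gamma>"
    using b(1) by (rule summable_on_cmult_right)
  have "(\<lambda>\<sigma>. cmod (F \<sigma> * ?c \<sigma>)) summable_on \<Gamma>"
    using Cb le by (rule summable_on_comparison_test) simp_all
  then show summable: "(\<lambda>\<sigma>. F \<sigma> * ?c \<sigma>) summable_on \<Gamma>"
    by (rule Infinite_Sum.abs_summable_summable)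
  have C: "0 \<le> C"
    using F[of "{}"] norm_ge_zero[of "F {}"] by (simp add: \<Gamma>_def lam_def del: norm_ge_zero)
  have "cmod (dual_pairing F \<xi>) \<le> (\<Sum>\<^sub>\<infinity>\<sigma>\<in>\<Gamma>. C * ?b \<sigma>)"
    unfolding dual_pairing_def
    using summable Cb le by (intro norm_infsum_le[OF has_sum_infsum has_sum_infsum])
  also have "\<dots> = C * infsum ?b \<Gamma>"
    by (rule infsum_cmult_right')
  also have "\<dots> \<le> C * (sqrt (\<Sum>\<^sub>\<infinity>\<sigma>\<in>\<Gamma>. (lam \<sigma> powr - 1)\<^sup>2) * Sp_norm P M (p + 1) \<xi>)"
    using b(2) C by (rule mult_left_mono)
  finally show "cmod (dual_pairing F \<xi>)
      \<le> C * sqrt (\<Sum>\<^sub>\<infinity>\<sigma>\<in>\<Gamma>. (lam \<sigma> powr - 1)\<^sup>2) * Sp_norm P M (p + 1) \<xi>"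
    by (simp add: mult.assoc)
qed

text \<open>Linearity holds because the defining series converges on test functionals. With linearity, the bound
  on the pairing becomes a Lipschitz estimate with respect to \<open>\<parallel>\<cdot>\<parallel>\<^sub>p\<^sub>+\<^sub>1\<close>, which gives continuity.\<close>

lemma dual_pairing_generalized_functional:
  assumes F: "\<And>\<sigma>. \<sigma> \<in> \<Gamma> \<Longrightarrow> cmod (F \<sigma>) \<le> C * lam \<sigma> powr p" and p: "0 \<le> p"
  shows "dual_pairing F \<in> generalized_functionals P M"
proof -
  have summable: "(\<lambda>\<sigma>. F \<sigma> * L2_inner P (Z M \<sigma>) \<xi>) summable_on \<Gamma>" if "\<xi> \<in> test_functionals P M" for \<xi>
    using dual_pairing_bound(1)[OF F that] .
  have add: "dual_pairing F (\<lambda>\<omega>. \<xi> \<omega> + \<eta> \<omega>) = dual_pairing F \<xi> + dual_pairing F \<eta>"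
    if \<xi>: "\<xi> \<in> test_functionals P M" and \<eta>: "\<eta> \<in> test_functionals P M" for \<xi> \<eta>
  proof -
    have "dual_pairing F (\<lambda>\<omega>. \<xi> \<omega> + \<eta> \<omega>)
        = (\<Sum>\<^sub>\<infinity>\<sigma>\<in>\<Gamma>. F \<sigma> * L2_inner P (Z M \<sigma>) \<xi> + F \<sigma> * L2_inner P (Z M \<sigma>) \<eta>)"
      unfolding dual_pairing_def using \<xi> \<eta>
      by (intro infsum_cong) (simp add: \<Gamma>_def test_functionals_iff coefficient_add distrib_left)
    then show ?thesis
      unfolding dual_pairing_def using infsum_add[OF summable[OF \<xi>] summable[OF \<eta>]] by simp
  qed
  have scale: "dual_pairing F (\<lambda>\<omega>. c * \<xi> \<omega>) = c * dual_pairing F \<xi>" for c \<xi>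
    unfolding dual_pairing_def coefficient_scale mult.left_commute[of _ c] by (rule infsum_cmult_right')
  \<comment> \<open>The summand 1 makes \<open>K\<close> positive even for \<open>C = 0\<close>, so that \<open>e / K\<close> below is a radius.\<close>
  define K where "K = C * sqrt (\<Sum>\<^sub>\<infinity>\<sigma>\<in>\<Gamma>. (lam \<sigma> powr - 1)\<^sup>2) + 1"
  have "0 \<le> C"
    using F[of "{}"] norm_ge_zero[of "F {}"] by (simp add: \<Gamma>_def lam_def del: norm_ge_zero)
  then have K: "0 < K"
    unfolding K_def by (intro add_nonneg_pos mult_nonneg_nonneg) (auto intro: infsum_nonneg)
  have lipschitz: "cmod (dual_pairing F \<eta> - dual_pairing F \<xi>) \<le> K * Sp_norm P M (p + 1) (\<lambda>\<omega>. \<eta> \<omega> - \<xi> \<omega>)"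
    if \<xi>: "\<xi> \<in> test_functionals P M" and \<eta>: "\<eta> \<in> test_functionals P M" for \<xi> \<eta>
  proof -
    have "dual_pairing F \<eta> - dual_pairing F \<xi> = dual_pairing F (\<lambda>\<omega>. \<eta> \<omega> - \<xi> \<omega>)"
      using add[OF test_functionals_diff[OF \<eta> \<xi>] \<xi>] by simp
    then have "cmod (dual_pairing F \<eta> - dual_pairing F \<xi>) \<le> (K - 1) * Sp_norm P M (p + 1) (\<lambda>\<omega>. \<eta> \<omega> - \<xi> \<omega>)"
      using dual_pairing_bound(2)[OF F test_functionals_diff[OF \<eta> \<xi>]] by (simp add: K_def)
    also have "\<dots> \<le> K * Sp_norm P M (p + 1) (\<lambda>\<omega>. \<eta> \<omega> - \<xi> \<omega>)"
      by (intro mult_right_mono) (auto simp: Sp_norm_def intro!: infsum_nonneg chaos_term_nonneg)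
    finally show ?thesis .
  qed
  have "continuous_map (test_topology P M) euclidean (dual_pairing F)"
    unfolding continuous_map_def topspace_test_topology
  proof (intro conjI allI impI)
    fix V :: "complex set" assume V: "openin euclidean V"
    let ?U = "{\<xi> \<in> test_functionals P M. dual_pairing F \<xi> \<in> V}"
    show "openin (test_topology P M) ?U"
      unfolding openin_subopen[of _ ?U]
    proof
      fix \<xi> assume \<xi>: "\<xi> \<in> ?U"
      then obtain e where e: "0 < e" "ball (dual_pairing F \<xi>) e \<subseteq> V"
        using V by (auto simp: open_contains_ball)
      let ?B = "{\<eta> \<in> test_functionals P M. Sp_norm P M (p + 1) (\<lambda>\<omega>. \<eta> \<omega> - \<xi> \<omega>) < e / K}"
      have "dual_pairing F \<eta> \<in> V" if \<eta>: "\<eta> \<in> ?B" for \<eta>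
      proof -
        have "K * Sp_norm P M (p + 1) (\<lambda>\<omega>. \<eta> \<omega> - \<xi> \<omega>) < e"
          using \<eta> K by (simp add: field_simps)
        then have "dist (dual_pairing F \<xi>) (dual_pairing F \<eta>) < e"
          using lipschitz[of \<xi> \<eta>] \<xi> \<eta> by (simp add: dist_norm norm_minus_commute)
        then show ?thesis
          using e(2) by auto
      qed
      moreover have "\<xi> \<in> ?B"
        using \<xi> e K by (simp add: Sp_norm_zero)
      moreover have "openin (test_topology P M) ?B"
        using \<xi> p e K by (intro test_topology_ball) auto
      ultimately show "\<exists>T. openin (test_topology P M) T \<and> \<xi> \<in> T \<and> T \<subseteq> ?U"
        by (intro exI[of _ ?B]) auto
    qed
  qed auto
  then show ?thesis
    using add scale by (auto simp: generalized_functionals_def)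
qed

lemma Fock_transform_dual_pairing:
  assumes "\<sigma> \<in> \<Gamma>"
  shows "Fock_transform M (dual_pairing F) \<sigma> = F \<sigma>"
proof -
  have "((\<lambda>\<tau>. F \<tau> * L2_inner P (Z M \<tau>) (Z M \<sigma>)) has_sum F \<sigma>) \<Gamma>"
    using assms by (intro has_sum_finite_neutralI[of "{\<sigma>}"]) (auto simp: \<Gamma>_def Z_orthonormal)
  then show ?thesis
    by (simp add: Fock_transform_def dual_pairing_def infsumI)
qed

end

theorem corollary4p4:
  fixes P :: "'a measure" and M :: "nat \<Rightarrow> 'a \<Rightarrow> real" and F :: "nat set \<Rightarrow> complex"
  assumes "normal_martingale P M"
    and "chaotic_representation P M"
  shows "(\<exists>\<Phi>\<in>generalized_functionals P M. \<forall>\<sigma>\<in>\<Gamma>. F \<sigma> = Fock_transform M \<Phi> \<sigma>) \<longleftrightarrow>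
    (\<exists>C p :: real. 0 \<le> C \<and> 0 \<le> p \<and> (\<forall>\<sigma>\<in>\<Gamma>. cmod (F \<sigma>) \<le> C * lam \<sigma> powr p))"
proof -
  interpret normal_martingale P M
    by fact
  show ?thesis
  proof
    assume "\<exists>\<Phi>\<in>generalized_functionals P M. \<forall>\<sigma>\<in>\<Gamma>. F \<sigma> = Fock_transform M \<Phi> \<sigma>"
    then show "\<exists>C p :: real. 0 \<le> C \<and> 0 \<le> p \<and> (\<forall>\<sigma>\<in>\<Gamma>. cmod (F \<sigma>) \<le> C * lam \<sigma> powr p)"
      using Fock_transform_bound by fastforce
  next
    assume "\<exists>C p :: real. 0 \<le> C \<and> 0 \<le> p \<and> (\<forall>\<sigma>\<in>\<Gamma>. cmod (F \<sigma>) \<le> C * lam \<sigma> powr p)"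
    then obtain C p where "0 \<le> p" "\<And>\<sigma>. \<sigma> \<in> \<Gamma> \<Longrightarrow> cmod (F \<sigma>) \<le> C * lam \<sigma> powr p"
      by blast
    then have "dual_pairing F \<in> generalized_functionals P M"
      by (intro dual_pairing_generalized_functional)
    then show "\<exists>\<Phi>\<in>generalized_functionals P M. \<forall>\<sigma>\<in>\<Gamma>. F \<sigma> = Fock_transform M \<Phi> \<sigma>"
      using Fock_transform_dual_pairing by (intro bexI[of _ "dual_pairing F"]) simp_all
  qed
qed

end
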